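(* Let $n,m\ge1$ be integers, let $1<p<\infty$ with $1/p+1/p'=1$, and let $\lambda,\alpha,\beta$ be real numbers with $0<\lambda<n+m$, $\alpha<m/p$, $\beta<m/p'$ and $n+m=\lambda+\alpha+\beta$. Write $w=(x,v)\in\mathbb{R}^n\times\mathbb{R}^m$. Then for every $f\in L^p(\mathbb{R}^{n+m})$, $$\big\|\,|v|^{-\alpha}\big(|w|^{-\lambda}*(|v|^{-\beta}f)\big)\big\|_{L^p(\mathbb{R}^{n+m})}\le G_{\alpha,\beta}\,\|f\|_{L^p(\mathbb{R}^{n+m})},$$ where $$G_{\alpha,\beta}=\pi^{(n+m)/2}\left[\frac{\Gamma\big(\frac{\alpha+\beta}{2}\big)\,\Gamma\big(\frac{m}{2p}-\frac{\alpha}{2}\big)\,\Gamma\big(\frac{m}{2p'}-\frac{\beta}{2}\big)}{\Gamma\big(\frac{n+m-\alpha-\beta}{2}\big)\,\Gamma\big(\frac{m}{2p'}+\frac{\alpha}{2}\big)\,\Gamma\big(\frac{m}{2p}+\frac{\beta}{2}\big)}\right].$$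
   Context: $*$ denotes convolution on $\mathbb{R}^{n+m}$, so that $\big(|w|^{-\lambda}*F\big)(w)=\int_{\mathbb{R}^{n+m}}|w-w'|^{-\lambda}F(w')\,dw'$, where $|w|=(|x|^2+|v|^2)^{1/2}$ is the Euclidean norm on $\mathbb{R}^{n+m}$. $\Gamma$ is the Euler Gamma function. *)

theory Defs
  imports "HOL-Analysis.Analysis"
begin

definition in_Lp :: "real \<Rightarrow> 'a measure \<Rightarrow> ('a \<Rightarrow> complex) \<Rightarrow> bool" where
  "in_Lp p M f \<longleftrightarrow> f \<in> borel_measurable M \<and> integrable M (\<lambda>w. norm (f w) powr p)"

text \<open>Only meaningful for functions satisfying \<open>in_Lp p M\<close>: the Bochner integral of a
  non-integrable function is 0.\<close>

definition Lp_norm :: "real \<Rightarrow> 'a measure \<Rightarrow> ('a \<Rightarrow> complex) \<Rightarrow> real" where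
  "Lp_norm p M f = (\<integral>w. norm (f w) powr p \<partial>M) powr (1 / p)"

text \<open>Convolution of a real kernel with a complex function with respect to Lebesgue measure. The
  integral equals 0 by convention at points where it does not converge absolutely;
  \<open>convolution_exists_at\<close> expresses that it does converge.\<close>

definition convolution ::
    "('a::euclidean_space \<Rightarrow> real) \<Rightarrow> ('a \<Rightarrow> complex) \<Rightarrow> 'a \<Rightarrow> complex" where
  "convolution K F w = (\<integral>w'. K (w - w') *\<^sub>R F w' \<partial>lebesgue)"

definition convolution_exists_at ::
    "('a::euclidean_space \<Rightarrow> real) \<Rightarrow> ('a \<Rightarrow> complex) \<Rightarrow> 'a \<Rightarrow> bool" where
  "convolution_exists_at K F w \<longleftrightarrow> integrable lebesgue (\<lambda>w'. K (w - w') *\<^sub>R F w')"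

text \<open>The kernel \<open>|w|\<^sup>-\<^sup>l\<close>. Since \<open>0 powr a = 0\<close>, it is 0 at the origin, and likewise the weight
  below is 0 on the null set where \<open>v = 0\<close>.\<close>

definition riesz_kernel :: "real \<Rightarrow> 'a::euclidean_space \<Rightarrow> real" where
  "riesz_kernel l w = norm w powr (- l)"

text \<open>Multiplication by \<open>|v|\<^sup>-\<^sup>a\<close>, where \<open>w = (x, v)\<close>. The norm of the product type is the Euclidean
  one, \<open>norm (x, v) = sqrt ((norm x)\<^sup>2 + (norm v)\<^sup>2)\<close>.\<close>

definition weighted ::
    "real \<Rightarrow> ((real ^ 'n) \<times> (real ^ 'm) \<Rightarrow> complex) \<Rightarrow> (real ^ 'n) \<times> (real ^ 'm) \<Rightarrow> complex" where
  "weighted a f w = (norm (snd w) powr (- a)) *\<^sub>R f w"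

definition G_const :: "nat \<Rightarrow> nat \<Rightarrow> real \<Rightarrow> real \<Rightarrow> real \<Rightarrow> real \<Rightarrow> real" where
  "G_const n m p p' \<alpha> \<beta> =
     pi powr (real (n + m) / 2) *
     ((Gamma ((\<alpha> + \<beta>) / 2) * Gamma (real m / (2 * p) - \<alpha> / 2) * Gamma (real m / (2 * p') - \<beta> / 2)) /
      (Gamma ((real (n + m) - \<alpha> - \<beta>) / 2) * Gamma (real m / (2 * p') + \<alpha> / 2) * Gamma (real m / (2 * p) + \<beta> / 2)))"

end

theory Submission
  imports "HOL-Probability.Distributions" Defs
begin

text \<open>
  The operator has the positive kernel \<open>|v|\<^sup>-\<^sup>\<alpha> |w - w'|\<^sup>-\<^sup>l |v'|\<^sup>-\<^sup>\<beta>\<close>, which is homogeneous of degree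
  \<open>- (n + m)\<close> and depends on \<open>x\<close> and \<open>x'\<close> through \<open>x - x'\<close> only. Schur's test
  (\<open>schur_kernel.schur_bound\<close>) with the weight \<open>h(w) = |v|\<^sup>-\<^sup>m\<^sup>/\<^sup>(\<^sup>p\<^sup>p\<^sup>'\<^sup>)\<close> bounds it on
  \<open>L\<^sup>p\<close>. The weight is a power of \<open>|v|\<close> alone, so by translation invariance in \<open>x\<close> and homogeneity both Schur integrals are multiples
  of the right power of \<open>|v|\<close>; the exponent \<open>m/(pp')\<close> makes \<open>h\<^sup>p\<^sup>'\<close> and \<open>h\<^sup>p\<close> equal to
  \<open>|v|\<^sup>-\<^sup>m\<^sup>/\<^sup>p\<close> and \<open>|v|\<^sup>-\<^sup>m\<^sup>/\<^sup>p\<^sup>'\<close>. For these, the hypotheses \<open>\<alpha> < m/p\<close> and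
  \<open>\<beta> < m/p'\<close> say precisely that both Schur integrals converge at \<open>v' = 0\<close> and at infinity, and the
  two multiples coincide: both are \<open>G\<^sub>\<alpha>\<^sub>\<beta>\<close>.

  The Schur integrals reduce to one computation, \<open>nn_integral_riesz_kernel_weight_le\<close>:
  \<open>\<integral> |w - w'|\<^sup>-\<^sup>l |v'|\<^sup>-\<^sup>s dw' = C |v|\<^sup>n\<^sup>+\<^sup>m\<^sup>-\<^sup>l\<^sup>-\<^sup>s\<close>. Each power of a norm is a superposition of
  Gaussians by Euler's integral for \<open>\<Gamma>\<close>. After an exchange of integrals the integral over \<open>w'\<close> is
  Gaussian, and the integral over the two parameters reduces to one Gamma and one Beta integral.

  All estimates are made for nonnegative extended integrals, where no convergence has to be known
  in advance; the almost everywhere existence of the convolution then comes out of Schur's test. The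
  Lebesgue measurable \<open>f\<close> is first replaced by a Borel function that agrees with it almost
  everywhere, since Tonelli's theorem needs product measurability.
\<close>

section \<open>Gamma and Beta integrals\<close>

text \<open>This is Euler's integral for \<open>\<Gamma>\<close> after the substitution \<open>t \<mapsto> r t\<close>. Read from right to left, it
  writes \<open>r\<^sup>-\<^sup>s\<close> as a superposition of exponentials.\<close>

lemma nn_integral_powr_exp:
  fixes s r :: real
  assumes s: "s > 0" and r: "r > 0"
  shows "(\<integral>\<^sup>+t. ennreal (indicator {0..} t * t powr (s - 1) * exp (- (r * t))) \<partial>lborel)
    = ennreal (Gamma s * r powr (- s))" (is "?I = _")
proof -
  have "ennreal (Gamma s) = (\<integral>\<^sup>+t. ennreal (indicator {0..} t * t powr (s - 1) / exp t) \<partial>lborel)"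
    by (rule Gamma_conv_nn_integral_real[OF s])
  also have "\<dots> = ennreal \<bar>r\<bar> *
      (\<integral>\<^sup>+t. ennreal (indicator {0..} (0 + r * t) * (0 + r * t) powr (s - 1) / exp (0 + r * t)) \<partial>lborel)"
    by (rule nn_integral_real_affine) (use r in auto)
  also have "(\<integral>\<^sup>+t. ennreal (indicator {0..} (0 + r * t) * (0 + r * t) powr (s - 1) / exp (0 + r * t)) \<partial>lborel)
      = (\<integral>\<^sup>+t. ennreal (r powr (s - 1)) *
            ennreal (indicator {0..} t * t powr (s - 1) * exp (- (r * t))) \<partial>lborel)"
    using r by (intro nn_integral_cong)
      (auto simp: indicator_def powr_mult exp_minus field_simps zero_le_mult_iff simp flip: ennreal_mult)
  also have "\<dots> = ennreal (r powr (s - 1)) * ?I"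
    by (intro nn_integral_cmult) auto
  finally have "ennreal (Gamma s) = ennreal (r powr s) * ?I"
    using r by (simp add: mult.assoc[symmetric] powr_diff flip: ennreal_mult)
  then have "ennreal (r powr (- s)) * ennreal (Gamma s) = ennreal (r powr (- s)) * ennreal (r powr s) * ?I"
    by (simp add: mult.assoc)
  also have "\<dots> = ?I"
    using r by (simp add: powr_minus flip: ennreal_mult)
  finally show ?thesis
    using s by (simp add: Gamma_real_pos less_imp_le mult.commute flip: ennreal_mult)
qed

text \<open>Writing \<open>\<Gamma>(x + y) (1 + u)\<^sup>-\<^sup>(\<^sup>x\<^sup>+\<^sup>y\<^sup>)\<close> as an integral of \<open>t\<^sup>x\<^sup>+\<^sup>y\<^sup>-\<^sup>1 e\<^sup>-\<^sup>(\<^sup>1\<^sup>+\<^sup>u\<^sup>)\<^sup>t\<close> over \<open>t\<close> and integrating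
  over \<open>u\<close> first separates the double integral into \<open>\<Gamma>(x)\<close> and \<open>\<Gamma>(y)\<close>.\<close>

lemma nn_integral_beta_second_kind:
  fixes x y :: real
  assumes x: "x > 0" and y: "y > 0"
  shows "(\<integral>\<^sup>+u. ennreal (indicator {0..} u * u powr (x - 1) * (1 + u) powr (- (x + y))) \<partial>lborel)
    = ennreal (Gamma x * Gamma y / Gamma (x + y))" (is "?I = _")
proof -
  define g where "g t u = indicator {0..} t * indicator {0..} u *
      t powr (x + y - 1) * u powr (x - 1) * exp (- ((1 + u) * t))" for t u :: real
  have [measurable]: "(\<lambda>(t, u). ennreal (g t u)) \<in> borel_measurable (lborel \<Otimes>\<^sub>M lborel)"
    unfolding g_def by measurable
  have pos: "Gamma (x + y) > 0" "Gamma x > 0" "Gamma y > 0"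
    using x y by (auto intro!: Gamma_real_pos)
  have "ennreal (Gamma (x + y)) * ?I
      = (\<integral>\<^sup>+u. ennreal (Gamma (x + y)) *
           ennreal (indicator {0..} u * u powr (x - 1) * (1 + u) powr (- (x + y))) \<partial>lborel)"
    by (intro nn_integral_cmult[symmetric]) auto
  also have "\<dots> = (\<integral>\<^sup>+u. \<integral>\<^sup>+t. ennreal (g t u) \<partial>lborel \<partial>lborel)"
  proof (intro nn_integral_cong)
    fix u :: real
    have "(\<integral>\<^sup>+t. ennreal (g t u) \<partial>lborel) = (\<integral>\<^sup>+t. ennreal (indicator {0..} u * u powr (x - 1)) *
        ennreal (indicator {0..} t * t powr (x + y - 1) * exp (- ((1 + u) * t))) \<partial>lborel)"
      by (intro nn_integral_cong) (simp add: g_def mult_ac flip: ennreal_mult)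
    also have "\<dots> = ennreal (indicator {0..} u * u powr (x - 1)) *
        (\<integral>\<^sup>+t. ennreal (indicator {0..} t * t powr (x + y - 1) * exp (- ((1 + u) * t))) \<partial>lborel)"
      by (intro nn_integral_cmult) auto
    also have "\<dots> = ennreal (Gamma (x + y)) *
        ennreal (indicator {0..} u * u powr (x - 1) * (1 + u) powr (- (x + y)))"
    proof (cases "u \<ge> 0")
      case True
      then show ?thesis
        using x y pos nn_integral_powr_exp[of "x + y" "1 + u"]
        by (simp add: mult_ac flip: ennreal_mult)
    qed auto
    finally show "ennreal (Gamma (x + y)) *
        ennreal (indicator {0..} u * u powr (x - 1) * (1 + u) powr (- (x + y)))
        = (\<integral>\<^sup>+t. ennreal (g t u) \<partial>lborel)" ..
  qed
  also have "\<dots> = (\<integral>\<^sup>+t. \<integral>\<^sup>+u. ennreal (g t u) \<partial>lborel \<partial>lborel)"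
    by (rule lborel_pair.Fubini') simp
  also have "\<dots> = (\<integral>\<^sup>+t. ennreal (Gamma x) *
      ennreal (indicator {0..} t * t powr (y - 1) * exp (- (1 * t))) \<partial>lborel)"
  proof (intro nn_integral_cong)
    fix t :: real
    have "(\<integral>\<^sup>+u. ennreal (g t u) \<partial>lborel)
      = (\<integral>\<^sup>+u. ennreal (indicator {0..} t * t powr (x + y - 1) * exp (- t)) *
          ennreal (indicator {0..} u * u powr (x - 1) * exp (- (t * u))) \<partial>lborel)"
      by (intro nn_integral_cong)
        (simp add: g_def mult_ac exp_add[symmetric] algebra_simps flip: ennreal_mult)
    also have "\<dots> = ennreal (indicator {0..} t * t powr (x + y - 1) * exp (- t)) *
        (\<integral>\<^sup>+u. ennreal (indicator {0..} u * u powr (x - 1) * exp (- (t * u))) \<partial>lborel)"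
      by (intro nn_integral_cmult) auto
    also have "\<dots> = ennreal (Gamma x) *
        ennreal (indicator {0..} t * t powr (y - 1) * exp (- (1 * t)))"
    proof (cases "t > 0")
      case True
      have "t powr (x + y - 1) * t powr (- x) = t powr (y - 1)"
        by (simp flip: powr_add)
      with True show ?thesis
        using x y pos nn_integral_powr_exp[of x t]
        by (simp add: mult_ac flip: ennreal_mult)
    qed (auto simp: indicator_def)
    finally show "(\<integral>\<^sup>+u. ennreal (g t u) \<partial>lborel) = ennreal (Gamma x) *
        ennreal (indicator {0..} t * t powr (y - 1) * exp (- (1 * t)))" .
  qed
  also have "\<dots> = ennreal (Gamma x) *
      (\<integral>\<^sup>+t. ennreal (indicator {0..} t * t powr (y - 1) * exp (- (1 * t))) \<partial>lborel)"
    by (intro nn_integral_cmult) auto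
  also have "\<dots> = ennreal (Gamma x * Gamma y)"
    using nn_integral_powr_exp[of y 1] y pos by (simp flip: ennreal_mult)
  finally have "ennreal (1 / Gamma (x + y)) * (ennreal (Gamma (x + y)) * ?I)
      = ennreal (1 / Gamma (x + y)) * ennreal (Gamma x * Gamma y)"
    by simp
  then show ?thesis
    using pos by (simp add: mult.assoc[symmetric] flip: ennreal_mult)
qed

section \<open>Gaussian integrals\<close>

text \<open>Completing the square: the integrand is a multiple of the normal density with mean
  \<open>t a / (s + t)\<close> and variance \<open>1 / (2 (s + t))\<close>.\<close>

lemma nn_integral_gaussian_product:
  fixes a s t :: real
  assumes s: "s \<ge> 0" and t: "t > 0"
  shows "(\<integral>\<^sup>+y. ennreal (exp (- (t * (a - y)\<^sup>2 + s * y\<^sup>2))) \<partial>lborel)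
    = ennreal (sqrt (pi / (s + t)) * exp (- (s * t / (s + t) * a\<^sup>2)))"
proof -
  define \<sigma> where "\<sigma> = 1 / sqrt (2 * (s + t))"
  define \<mu> where "\<mu> = t * a / (s + t)"
  have st: "s + t > 0" using s t by simp
  have \<sigma>: "\<sigma> > 0" "\<sigma>\<^sup>2 = 1 / (2 * (s + t))"
    using st by (auto simp: \<sigma>_def power_divide)
  have "(\<integral>\<^sup>+y. ennreal (exp (- (t * (a - y)\<^sup>2 + s * y\<^sup>2))) \<partial>lborel)
    = (\<integral>\<^sup>+y. ennreal (sqrt (pi / (s + t)) * exp (- (s * t / (s + t) * a\<^sup>2))) *
          ennreal (normal_density \<mu> \<sigma> y) \<partial>lborel)"
  proof (intro nn_integral_cong)
    fix y :: real
    have "- (t * (a - y)\<^sup>2 + s * y\<^sup>2) = - (s * t / (s + t) * a\<^sup>2) - (s + t) * (y - \<mu>)\<^sup>2"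
      using st unfolding \<mu>_def by (simp add: divide_simps power2_eq_square) algebra
    then have "exp (- (t * (a - y)\<^sup>2 + s * y\<^sup>2))
        = exp (- (s * t / (s + t) * a\<^sup>2)) * exp (- ((s + t) * (y - \<mu>)\<^sup>2))"
      by (simp flip: exp_add)
    moreover have "normal_density \<mu> \<sigma> y = 1 / sqrt (pi / (s + t)) * exp (- ((s + t) * (y - \<mu>)\<^sup>2))"
    proof -
      have "2 * pi * \<sigma>\<^sup>2 = pi / (s + t)" "2 * \<sigma>\<^sup>2 = 1 / (s + t)"
        using st by (simp_all add: \<sigma> field_simps)
      then show ?thesis
        by (simp add: normal_density_def mult.commute)
    qed
    ultimately show "ennreal (exp (- (t * (a - y)\<^sup>2 + s * y\<^sup>2)))
        = ennreal (sqrt (pi / (s + t)) * exp (- (s * t / (s + t) * a\<^sup>2))) *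
          ennreal (normal_density \<mu> \<sigma> y)"
      using st by (simp flip: ennreal_mult)
  qed
  also have "\<dots> = ennreal (sqrt (pi / (s + t)) * exp (- (s * t / (s + t) * a\<^sup>2))) *
      (\<integral>\<^sup>+y. ennreal (normal_density \<mu> \<sigma> y) \<partial>lborel)"
    by (intro nn_integral_cmult) auto
  also have "(\<integral>\<^sup>+y. ennreal (normal_density \<mu> \<sigma> y) \<partial>lborel) = 1"
    using \<sigma>(1) by (subst nn_integral_eq_integral) auto
  finally show ?thesis by simp
qed

lemma nn_integral_gaussian_product_euclidean:
  fixes a :: "'a::euclidean_space" and s t :: real
  assumes s: "s \<ge> 0" and t: "t > 0"
  shows "(\<integral>\<^sup>+y. ennreal (exp (- (t * (norm (a - y))\<^sup>2 + s * (norm y)\<^sup>2))) \<partial>lborel)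
    = ennreal ((pi / (s + t)) powr (real DIM('a) / 2) * exp (- (s * t / (s + t) * (norm a)\<^sup>2)))"
proof -
  have st: "s + t > 0" using s t by simp
  have sq: "(norm z)\<^sup>2 = (\<Sum>b\<in>Basis. (z \<bullet> b)\<^sup>2)" for z :: 'a
    unfolding power2_norm_eq_inner by (subst euclidean_inner) (simp add: power2_eq_square)
  have "(\<integral>\<^sup>+y. ennreal (exp (- (t * (norm (a - y))\<^sup>2 + s * (norm y)\<^sup>2))) \<partial>lborel)
    = (\<integral>\<^sup>+y. (\<Prod>b\<in>Basis. ennreal (exp (- (t * (a \<bullet> b - y \<bullet> b)\<^sup>2 + s * (y \<bullet> b)\<^sup>2)))) \<partial>lborel)"
  proof (intro nn_integral_cong)
    fix y :: 'a
    have "- (t * (norm (a - y))\<^sup>2 + s * (norm y)\<^sup>2)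
        = (\<Sum>b\<in>Basis. - (t * (a \<bullet> b - y \<bullet> b)\<^sup>2 + s * (y \<bullet> b)\<^sup>2))"
      by (simp add: sq inner_diff_left sum.distrib sum_negf sum_subtractf sum_distrib_left)
    then show "ennreal (exp (- (t * (norm (a - y))\<^sup>2 + s * (norm y)\<^sup>2)))
        = (\<Prod>b\<in>Basis. ennreal (exp (- (t * (a \<bullet> b - y \<bullet> b)\<^sup>2 + s * (y \<bullet> b)\<^sup>2))))"
      by (simp add: exp_sum prod_ennreal)
  qed
  also have "\<dots> = (\<Prod>b\<in>Basis. \<integral>\<^sup>+y. ennreal (exp (- (t * (a \<bullet> b - y)\<^sup>2 + s * y\<^sup>2))) \<partial>lborel)"
    by (intro nn_integral_lborel_prod) auto
  also have "\<dots> = (\<Prod>b\<in>(Basis :: 'a set). ennreal (sqrt (pi / (s + t)) * exp (- (s * t / (s + t) * (a \<bullet> b)\<^sup>2))))"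
    by (simp only: nn_integral_gaussian_product[OF s t])
  also have "\<dots> = ennreal (\<Prod>b\<in>(Basis :: 'a set). sqrt (pi / (s + t)) * exp (- (s * t / (s + t) * (a \<bullet> b)\<^sup>2)))"
    using st by (intro prod_ennreal) auto
  also have "(\<Prod>b\<in>(Basis :: 'a set). sqrt (pi / (s + t)) * exp (- (s * t / (s + t) * (a \<bullet> b)\<^sup>2)))
      = sqrt (pi / (s + t)) ^ DIM('a) * exp (- (s * t / (s + t) * (norm a)\<^sup>2))"
    by (simp add: prod.distrib sq exp_sum[symmetric] sum_distrib_left sum_negf)
  also have "sqrt (pi / (s + t)) ^ DIM('a) = (pi / (s + t)) powr (real DIM('a) / 2)"
    using st by (simp add: powr_half_sqrt[symmetric] powr_powr flip: powr_realpow)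
  finally show ?thesis .
qed

text \<open>The second Gaussian is constant in the first factor, so this factor falls under the same formula
  with \<open>s = 0\<close>.\<close>

lemma nn_integral_gaussian_product_Pair:
  fixes x :: "'a::euclidean_space" and v :: "'b::euclidean_space" and s t :: real
  assumes s: "s \<ge> 0" and t: "t > 0"
  shows "(\<integral>\<^sup>+w'. ennreal (exp (- (t * (norm ((x, v) - w'))\<^sup>2 + s * (norm (snd w'))\<^sup>2))) \<partial>lborel)
    = ennreal ((pi / t) powr (real DIM('a) / 2) * (pi / (s + t)) powr (real DIM('b) / 2)
        * exp (- (s * t / (s + t) * (norm v)\<^sup>2)))"
proof -
  have "(\<integral>\<^sup>+w'. ennreal (exp (- (t * (norm ((x, v) - w'))\<^sup>2 + s * (norm (snd w'))\<^sup>2))) \<partial>lborel)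
    = (\<integral>\<^sup>+w'. ennreal (exp (- (t * (norm (x - fst w'))\<^sup>2 + 0 * (norm (fst w'))\<^sup>2))) *
           ennreal (exp (- (t * (norm (v - snd w'))\<^sup>2 + s * (norm (snd w'))\<^sup>2)))
           \<partial>(lborel \<Otimes>\<^sub>M lborel))"
    by (auto simp: lborel_prod norm_prod_def algebra_simps
        intro!: nn_integral_cong simp flip: ennreal_mult exp_add)
  also have "\<dots> = (\<integral>\<^sup>+x'. \<integral>\<^sup>+v'. ennreal (exp (- (t * (norm (x - x'))\<^sup>2 + 0 * (norm x')\<^sup>2))) *
       ennreal (exp (- (t * (norm (v - v'))\<^sup>2 + s * (norm v')\<^sup>2))) \<partial>lborel \<partial>lborel)"
    by (subst lborel.nn_integral_fst[symmetric]) auto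
  also have "\<dots> = (\<integral>\<^sup>+x'. ennreal (exp (- (t * (norm (x - x'))\<^sup>2 + 0 * (norm x')\<^sup>2))) *
      (\<integral>\<^sup>+v'. ennreal (exp (- (t * (norm (v - v'))\<^sup>2 + s * (norm v')\<^sup>2))) \<partial>lborel) \<partial>lborel)"
    by (intro nn_integral_cong nn_integral_cmult) auto
  also have "\<dots> = (\<integral>\<^sup>+x'. ennreal (exp (- (t * (norm (x - x'))\<^sup>2 + 0 * (norm x')\<^sup>2))) \<partial>lborel) *
      (\<integral>\<^sup>+v'. ennreal (exp (- (t * (norm (v - v'))\<^sup>2 + s * (norm v')\<^sup>2))) \<partial>lborel)"
    by (intro nn_integral_multc) auto
  also have "\<dots> = ennreal ((pi / t) powr (real DIM('a) / 2)) *
      ennreal ((pi / (s + t)) powr (real DIM('b) / 2) * exp (- (s * t / (s + t) * (norm v)\<^sup>2)))"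
    by (simp only: nn_integral_gaussian_product_euclidean[OF s t]
        nn_integral_gaussian_product_euclidean[OF order_refl t]) simp
  finally show ?thesis
    by (simp add: mult.assoc flip: ennreal_mult)
qed

section \<open>The Riesz kernel integrated against a power of a partial norm\<close>

text \<open>Homogeneity in \<open>(s, t)\<close> suggests \<open>s = t u\<close>. For fixed \<open>u\<close> the integral over \<open>t\<close> is then a Gamma
  integral of order \<open>A + B - k\<close>, and what is left in \<open>u\<close> is a Beta integral of the second kind with
  parameters \<open>k - A\<close> and \<open>k - B\<close>. The three hypotheses say that these three parameters are
  positive.\<close>

lemma nn_integral_gaussian_parameters:
  fixes A B k r :: real
  assumes AB: "k < A + B" and A: "A < k" and B: "B < k" and r: "r > 0"
  shows "(\<integral>\<^sup>+t. \<integral>\<^sup>+s. ennreal (indicator {0..} t * indicator {0..} s * t powr (A - 1) * s powr (B - 1)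
      * (s + t) powr (- k) * exp (- (s * t / (s + t) * r))) \<partial>lborel \<partial>lborel)
    = ennreal (Gamma (A + B - k) * Gamma (k - A) * Gamma (k - B) / Gamma (2 * k - A - B)
        * r powr (- (A + B - k)))" (is "?I = _")
proof -
  define D where "D = A + B - k"
  have D: "D > 0" using AB by (simp add: D_def)
  define g where "g t u = indicator {0..} t * indicator {0..} u * t powr (D - 1) * u powr (B - 1)
      * (1 + u) powr (- k) * exp (- (u / (1 + u) * r * t))" for t u :: real
  have [measurable]: "(\<lambda>(t, u). ennreal (g t u)) \<in> borel_measurable (lborel \<Otimes>\<^sub>M lborel)"
    unfolding g_def by measurable
  have pos: "Gamma D > 0" "Gamma (k - A) > 0" "Gamma (k - B) > 0"
    using D A B by (auto intro!: Gamma_real_pos)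
  have "?I = (\<integral>\<^sup>+t. \<integral>\<^sup>+u. ennreal (g t u) \<partial>lborel \<partial>lborel)"
  proof (rule nn_integral_cong)
    fix t :: real
    show "(\<integral>\<^sup>+s. ennreal (indicator {0..} t * indicator {0..} s * t powr (A - 1) * s powr (B - 1)
        * (s + t) powr (- k) * exp (- (s * t / (s + t) * r))) \<partial>lborel)
      = (\<integral>\<^sup>+u. ennreal (g t u) \<partial>lborel)" (is "(\<integral>\<^sup>+s. ennreal (?h s) \<partial>lborel) = _")
    proof (cases "t > 0")
      case True
      have "(\<integral>\<^sup>+s. ennreal (?h s) \<partial>lborel) = ennreal \<bar>t\<bar> * (\<integral>\<^sup>+u. ennreal (?h (0 + t * u)) \<partial>lborel)"
        by (rule nn_integral_real_affine) (use True in auto)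
      also have "\<dots> = (\<integral>\<^sup>+u. ennreal \<bar>t\<bar> * ennreal (?h (0 + t * u)) \<partial>lborel)"
        by (intro nn_integral_cmult[symmetric]) auto
      also have "\<dots> = (\<integral>\<^sup>+u. ennreal (g t u) \<partial>lborel)"
      proof (intro nn_integral_cong)
        fix u :: real
        have "\<bar>t\<bar> * ?h (0 + t * u) = g t u"
        proof (cases "u \<ge> 0")
          case u: True
          have e: "t * u + t = t * (1 + u)" by (simp add: algebra_simps)
          have "t * (t powr (A - 1) * (t * u) powr (B - 1) * (t * u + t) powr (- k))
              = (t powr 1 * t powr (A - 1) * t powr (B - 1) * t powr (- k)) * u powr (B - 1) * (1 + u) powr (- k)"
            unfolding e using True u by (simp add: powr_mult mult_ac)
          also have "t powr 1 * t powr (A - 1) * t powr (B - 1) * t powr (- k) = t powr (D - 1)"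
            unfolding D_def powr_add[symmetric] by (simp add: algebra_simps)
          moreover have "t * u * t / (t * u + t) * r = u / (1 + u) * r * t"
            unfolding e using True by simp
          ultimately show ?thesis
            using True u by (simp add: g_def mult.assoc mult.commute mult.left_commute)
        next
          case False
          then show ?thesis using True by (simp add: g_def indicator_def zero_le_mult_iff)
        qed
        then show "ennreal \<bar>t\<bar> * ennreal (?h (0 + t * u)) = ennreal (g t u)"
          by (simp flip: ennreal_mult')
      qed
      finally show ?thesis .
    next
      case False
      then have "t < 0 \<or> t = 0" by linarith
      then have h: "?h s = 0" "g t s = 0" for s by (auto simp: g_def)
      show ?thesis by (simp only: h)
    qed
  qed
  also have "\<dots> = (\<integral>\<^sup>+u. \<integral>\<^sup>+t. ennreal (g t u) \<partial>lborel \<partial>lborel)"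
    by (rule lborel_pair.Fubini'[symmetric]) simp
  also have "\<dots> = (\<integral>\<^sup>+u. ennreal (Gamma D * r powr (- D)) *
      ennreal (indicator {0..} u * u powr ((k - A) - 1) * (1 + u) powr (- ((k - A) + (k - B)))) \<partial>lborel)"
  proof (intro nn_integral_cong)
    fix u :: real
    have "(\<integral>\<^sup>+t. ennreal (g t u) \<partial>lborel)
      = (\<integral>\<^sup>+t. ennreal (indicator {0..} u * u powr (B - 1) * (1 + u) powr (- k)) *
          ennreal (indicator {0..} t * t powr (D - 1) * exp (- (u / (1 + u) * r * t))) \<partial>lborel)"
      by (intro nn_integral_cong) (simp add: g_def mult_ac flip: ennreal_mult)
    also have "\<dots> = ennreal (indicator {0..} u * u powr (B - 1) * (1 + u) powr (- k)) *
        (\<integral>\<^sup>+t. ennreal (indicator {0..} t * t powr (D - 1) * exp (- (u / (1 + u) * r * t))) \<partial>lborel)"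
      by (intro nn_integral_cmult) auto
    also have "\<dots> = ennreal (Gamma D * r powr (- D)) *
      ennreal (indicator {0..} u * u powr ((k - A) - 1) * (1 + u) powr (- ((k - A) + (k - B))))"
    proof (cases "u > 0")
      case True
      have "u powr (B - 1) * (1 + u) powr (- k) * (u / (1 + u) * r) powr (- D)
          = (u powr (B - 1) * u powr (- D)) * ((1 + u) powr (- k) * (1 + u) powr D) * r powr (- D)"
        using True r by (simp add: powr_mult powr_divide powr_minus field_simps)
      also have "u powr (B - 1) * u powr (- D) = u powr ((k - A) - 1)"
        unfolding powr_add[symmetric] by (simp add: D_def)
      also have "(1 + u) powr (- k) * (1 + u) powr D = (1 + u) powr (- ((k - A) + (k - B)))"
        unfolding powr_add[symmetric] by (simp add: D_def algebra_simps)
      finally have "u powr (B - 1) * (1 + u) powr (- k) * (Gamma D * (u / (1 + u) * r) powr (- D))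
          = Gamma D * r powr (- D) * (u powr ((k - A) - 1) * (1 + u) powr (- ((k - A) + (k - B))))"
        by (simp add: mult_ac)
      then show ?thesis
        using True D r pos nn_integral_powr_exp[of D "u / (1 + u) * r"]
        by (simp flip: ennreal_mult)
    qed (auto simp: indicator_def)
    finally show "(\<integral>\<^sup>+t. ennreal (g t u) \<partial>lborel) = ennreal (Gamma D * r powr (- D)) *
      ennreal (indicator {0..} u * u powr ((k - A) - 1) * (1 + u) powr (- ((k - A) + (k - B))))" .
  qed
  also have "\<dots> = ennreal (Gamma D * r powr (- D)) * (\<integral>\<^sup>+u.
      ennreal (indicator {0..} u * u powr ((k - A) - 1) * (1 + u) powr (- ((k - A) + (k - B)))) \<partial>lborel)"
    by (intro nn_integral_cmult) auto
  also have "\<dots> = ennreal (Gamma D * r powr (- D)) *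
      ennreal (Gamma (k - A) * Gamma (k - B) / Gamma ((k - A) + (k - B)))"
    using A B by (subst nn_integral_beta_second_kind) auto
  also have "\<dots> = ennreal (Gamma D * Gamma (k - A) * Gamma (k - B) / Gamma (2 * k - A - B) * r powr (- D))"
    using pos by (subst ennreal_mult'[symmetric]) (auto simp: mult_ac algebra_simps)
  finally show ?thesis unfolding D_def .
qed

text \<open>For \<open>z \<noteq> 0\<close> both sides agree. At \<open>z = 0\<close> the left-hand side is \<open>0\<close> by the convention for
  \<open>powr\<close>, while the integral diverges; with an inequality this point needs no exception, and Schur's
  test asks only for upper bounds.\<close>

lemma norm_powr_le_gaussian_superposition:
  fixes z :: "'a::real_normed_vector" and s :: real
  assumes s: "s > 0"
  shows "ennreal (norm z powr (- s)) \<le> ennreal (1 / Gamma (s / 2)) *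
    (\<integral>\<^sup>+t. ennreal (indicator {0..} t * t powr (s / 2 - 1) * exp (- ((norm z)\<^sup>2 * t))) \<partial>lborel)"
proof (cases "z = 0")
  case False
  have "(norm z)\<^sup>2 powr (- (s / 2)) = norm z powr (- s)"
    using False by (simp add: powr_powr flip: powr_numeral)
  moreover have G: "Gamma (s / 2) > 0" using s by (intro Gamma_real_pos) auto
  moreover have "Gamma (s / 2) \<noteq> 0" using G by linarith
  ultimately show ?thesis
    using False s nn_integral_powr_exp[of "s / 2" "(norm z)\<^sup>2"] by (simp flip: ennreal_mult)
qed auto

text \<open>The constant \<open>C\<close> in \<open>\<integral> |w - w'|\<^sup>-\<^sup>l |v'|\<^sup>-\<^sup>s dw' = C |v|\<^sup>n\<^sup>+\<^sup>m\<^sup>-\<^sup>l\<^sup>-\<^sup>s\<close> over \<open>\<real>\<^sup>n \<times> \<real>\<^sup>m\<close>. It is the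
  product of the constant for integrating out \<open>x'\<close> and the one for convolving two Riesz kernels on
  \<open>\<real>\<^sup>m\<close>.\<close>

definition riesz_const :: "nat \<Rightarrow> nat \<Rightarrow> real \<Rightarrow> real \<Rightarrow> real" where
  "riesz_const n m l s = pi powr (real (n + m) / 2) *
     (Gamma ((l + s - real n - real m) / 2) * Gamma ((real n + real m - l) / 2) * Gamma ((real m - s) / 2)) /
     (Gamma (l / 2) * Gamma (s / 2) * Gamma ((real n + 2 * real m - l - s) / 2))"

text \<open>Both powers become superpositions of Gaussians, with parameters \<open>t\<close> and \<open>u\<close>. The Gaussian integral
  over \<open>x'\<close> contributes \<open>t\<^sup>-\<^sup>n\<^sup>/\<^sup>2\<close>, which lowers the exponent \<open>l/2 - 1\<close> to \<open>(l - n)/2 - 1\<close>. The integral over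
  \<open>v'\<close> contributes \<open>(u + t)\<^sup>-\<^sup>m\<^sup>/\<^sup>2\<close> and the exponential, so that
  \<open>nn_integral_gaussian_parameters\<close> applies with \<open>A = (l - n)/2\<close>, \<open>B = s/2\<close> and \<open>k = m/2\<close>.\<close>

lemma nn_integral_riesz_kernel_weight_le:
  fixes x :: "'a::euclidean_space" and v :: "'b::euclidean_space" and l s :: real
  assumes v: "v \<noteq> 0" and l: "l < DIM('a) + DIM('b)" and s: "s < DIM('b)"
    and ls: "DIM('a) + DIM('b) < l + s"
  shows "(\<integral>\<^sup>+w'. ennreal (norm ((x, v) - w') powr (- l) * norm (snd w') powr (- s)) \<partial>lborel)
    \<le> ennreal (riesz_const DIM('a) DIM('b) l s * norm v powr (real (DIM('a) + DIM('b)) - l - s))"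
proof -
  define n m where "n = real DIM('a)" and "m = real DIM('b)"
  have n: "n > 0" and m: "m > 0" by (auto simp: n_def m_def)
  have l0: "l > 0" and s0: "s > 0" using l s ls n m by (auto simp: n_def m_def)
  have G: "Gamma (l / 2) > 0" "Gamma (s / 2) > 0" using l0 s0 by (auto intro!: Gamma_real_pos)
  define c where "c = 1 / Gamma (l / 2) * (1 / Gamma (s / 2))"
  have c: "ennreal c = ennreal (1 / Gamma (l / 2)) * ennreal (1 / Gamma (s / 2))"
    using G unfolding c_def by (intro ennreal_mult) auto
  define g where "g \<tau> = indicator {0..} (fst \<tau>) * indicator {0..} (snd \<tau>) *
      fst \<tau> powr (l / 2 - 1) * snd \<tau> powr (s / 2 - 1)" for \<tau> :: "real \<times> real"
  define E where "E w' \<tau> = exp (- (fst \<tau> * (norm ((x, v) - w'))\<^sup>2 + snd \<tau> * (norm (snd w'))\<^sup>2))"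
    for w' :: "'a \<times> 'b" and \<tau> :: "real \<times> real"
  have [measurable]: "g \<in> borel_measurable (borel \<Otimes>\<^sub>M borel)"
    unfolding g_def by measurable
  then have [measurable]: "g \<in> borel_measurable borel"
    by (simp add: borel_prod)
  \<comment> \<open>Joint continuity is the short way here: the Borel sets of the product type and the product of
    the Borel sets occur side by side in \<open>E\<close>.\<close>
  have "case_prod E \<in> borel_measurable borel"
    unfolding E_def case_prod_beta by (intro borel_measurable_continuous_onI continuous_intros)
  then have [measurable]: "(\<lambda>(w', \<tau>). E w' \<tau>) \<in> borel_measurable (borel \<Otimes>\<^sub>M borel)"
    by (simp add: borel_prod)
  have gnn: "g \<tau> \<ge> 0" for \<tau> by (simp add: g_def)
  have Enn: "E w' \<tau> \<ge> 0" for w' \<tau> by (simp add: E_def)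
  have "(\<integral>\<^sup>+w'. ennreal (norm ((x, v) - w') powr (- l) * norm (snd w') powr (- s)) \<partial>lborel)
    \<le> (\<integral>\<^sup>+w'. ennreal c * (\<integral>\<^sup>+\<tau>. ennreal (g \<tau> * E w' \<tau>) \<partial>lborel) \<partial>lborel)"
  proof (intro nn_integral_mono)
    fix w' :: "'a \<times> 'b"
    let ?T = "\<lambda>t. ennreal (indicator {0..} t * t powr (l / 2 - 1) * exp (- ((norm ((x, v) - w'))\<^sup>2 * t)))"
    let ?S = "\<lambda>t. ennreal (indicator {0..} t * t powr (s / 2 - 1) * exp (- ((norm (snd w'))\<^sup>2 * t)))"
    have "ennreal (norm ((x, v) - w') powr (- l) * norm (snd w') powr (- s))
      \<le> (ennreal (1 / Gamma (l / 2)) * (\<integral>\<^sup>+t. ?T t \<partial>lborel)) *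
          (ennreal (1 / Gamma (s / 2)) * (\<integral>\<^sup>+t. ?S t \<partial>lborel))"
      using norm_powr_le_gaussian_superposition[OF l0, of "(x, v) - w'"]
        norm_powr_le_gaussian_superposition[OF s0, of "snd w'"]
      by (simp add: ennreal_mult mult_mono)
    also have "\<dots> = ennreal c * ((\<integral>\<^sup>+t. ?T t \<partial>lborel) * (\<integral>\<^sup>+t. ?S t \<partial>lborel))"
      unfolding c by (simp only: mult_ac)
    also have "(\<integral>\<^sup>+t. ?T t \<partial>lborel) * (\<integral>\<^sup>+t. ?S t \<partial>lborel)
        = (\<integral>\<^sup>+t. \<integral>\<^sup>+u. ?T t * ?S u \<partial>lborel \<partial>lborel)"
      by (simp add: nn_integral_cmult nn_integral_multc)
    also have "\<dots> = (\<integral>\<^sup>+\<tau>. ?T (fst \<tau>) * ?S (snd \<tau>) \<partial>(lborel \<Otimes>\<^sub>M lborel))"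
      by (subst lborel.nn_integral_fst[symmetric]) auto
    also have "\<dots> = (\<integral>\<^sup>+\<tau>. ennreal (g \<tau> * E w' \<tau>) \<partial>lborel)"
    proof (simp only: lborel_prod, rule nn_integral_cong)
      fix \<tau> :: "real \<times> real"
      have "E w' \<tau> = exp (- ((norm ((x, v) - w'))\<^sup>2 * fst \<tau>)) * exp (- ((norm (snd w'))\<^sup>2 * snd \<tau>))"
        by (simp add: E_def algebra_simps flip: exp_add)
      then show "?T (fst \<tau>) * ?S (snd \<tau>) = ennreal (g \<tau> * E w' \<tau>)"
        by (simp add: g_def mult_ac flip: ennreal_mult)
    qed
    finally show "ennreal (norm ((x, v) - w') powr (- l) * norm (snd w') powr (- s))
      \<le> ennreal c * (\<integral>\<^sup>+\<tau>. ennreal (g \<tau> * E w' \<tau>) \<partial>lborel)" .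
  qed
  also have "\<dots> = ennreal c * (\<integral>\<^sup>+w'. \<integral>\<^sup>+\<tau>. ennreal (g \<tau> * E w' \<tau>) \<partial>lborel \<partial>lborel)"
    by (intro nn_integral_cmult) measurable
  also have "(\<integral>\<^sup>+w'. \<integral>\<^sup>+\<tau>. ennreal (g \<tau> * E w' \<tau>) \<partial>lborel \<partial>lborel)
      = (\<integral>\<^sup>+\<tau>. \<integral>\<^sup>+w'. ennreal (g \<tau> * E w' \<tau>) \<partial>lborel \<partial>lborel)"
    by (rule lborel_pair.Fubini'[symmetric]) measurable
  also have "\<dots> = (\<integral>\<^sup>+\<tau>. ennreal (g \<tau> * ((pi / fst \<tau>) powr (n / 2) * (pi / (snd \<tau> + fst \<tau>)) powr (m / 2)
        * exp (- (snd \<tau> * fst \<tau> / (snd \<tau> + fst \<tau>) * (norm v)\<^sup>2)))) \<partial>lborel)"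
  proof (intro nn_integral_cong)
    fix \<tau> :: "real \<times> real"
    have "(\<integral>\<^sup>+w'. ennreal (g \<tau> * E w' \<tau>) \<partial>lborel) = ennreal (g \<tau>) * (\<integral>\<^sup>+w'. ennreal (E w' \<tau>) \<partial>lborel)"
      by (subst nn_integral_cmult[symmetric]) (auto simp: gnn Enn ennreal_mult)
    also have "\<dots> = ennreal (g \<tau> * ((pi / fst \<tau>) powr (n / 2) * (pi / (snd \<tau> + fst \<tau>)) powr (m / 2)
        * exp (- (snd \<tau> * fst \<tau> / (snd \<tau> + fst \<tau>) * (norm v)\<^sup>2))))"
    proof (cases "fst \<tau> > 0 \<and> snd \<tau> \<ge> 0")
      case True
      then show ?thesis
        unfolding E_def n_def m_def
        by (subst nn_integral_gaussian_product_Pair) (simp_all add: gnn ennreal_mult)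
    next
      case False
      then have "g \<tau> = 0" by (auto simp: g_def indicator_def)
      then show ?thesis by simp
    qed
    finally show "(\<integral>\<^sup>+w'. ennreal (g \<tau> * E w' \<tau>) \<partial>lborel) =
      ennreal (g \<tau> * ((pi / fst \<tau>) powr (n / 2) * (pi / (snd \<tau> + fst \<tau>)) powr (m / 2)
        * exp (- (snd \<tau> * fst \<tau> / (snd \<tau> + fst \<tau>) * (norm v)\<^sup>2))))" .
  qed
  also have "\<dots> = (\<integral>\<^sup>+t. \<integral>\<^sup>+u. ennreal (g (t, u) * ((pi / t) powr (n / 2) * (pi / (u + t)) powr (m / 2)
        * exp (- (u * t / (u + t) * (norm v)\<^sup>2)))) \<partial>lborel \<partial>lborel)"
      (is "(\<integral>\<^sup>+\<tau>. ?f \<tau> \<partial>lborel) = _")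
  proof -
    have "?f \<in> borel_measurable (borel \<Otimes>\<^sub>M borel)"
      by measurable
    then have "?f \<in> borel_measurable (lborel \<Otimes>\<^sub>M lborel)"
      by (simp add: borel_prod lborel_prod)
    from lborel.nn_integral_fst[OF this] show ?thesis
      by (simp add: lborel_prod)
  qed
  also have "\<dots> = (\<integral>\<^sup>+t. \<integral>\<^sup>+u. ennreal (pi powr ((n + m) / 2)) *
      ennreal (indicator {0..} t * indicator {0..} u * t powr ((l - n) / 2 - 1) * u powr (s / 2 - 1)
      * (u + t) powr (- (m / 2)) * exp (- (u * t / (u + t) * (norm v)\<^sup>2))) \<partial>lborel \<partial>lborel)"
  proof (intro nn_integral_cong)
    fix t u :: real
    show "ennreal (g (t, u) * ((pi / t) powr (n / 2) * (pi / (u + t)) powr (m / 2)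
        * exp (- (u * t / (u + t) * (norm v)\<^sup>2)))) = ennreal (pi powr ((n + m) / 2)) *
      ennreal (indicator {0..} t * indicator {0..} u * t powr ((l - n) / 2 - 1) * u powr (s / 2 - 1)
      * (u + t) powr (- (m / 2)) * exp (- (u * t / (u + t) * (norm v)\<^sup>2)))"
    proof (cases "t > 0 \<and> u \<ge> 0")
      case True
      have e: "t powr (l / 2 - 1) * t powr (- (n / 2)) = t powr ((l - n) / 2 - 1)"
        unfolding powr_add[symmetric] by (simp add: diff_divide_distrib algebra_simps)
      have e2: "(pi / t) powr (n / 2) = pi powr (n / 2) * t powr (- (n / 2))"
        "(pi / (u + t)) powr (m / 2) = pi powr (m / 2) * (u + t) powr (- (m / 2))"
        using True by (auto simp: powr_divide powr_minus field_simps)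
      have e3: "pi powr ((n + m) / 2) = pi powr (n / 2) * pi powr (m / 2)"
        by (simp add: add_divide_distrib powr_add)
      show ?thesis
        unfolding e[symmetric] e2 e3 g_def using True
        by (simp add: mult_ac flip: ennreal_mult)
    qed (auto simp: g_def indicator_def)
  qed
  also have "\<dots> = ennreal (pi powr ((n + m) / 2)) * (\<integral>\<^sup>+t. \<integral>\<^sup>+u. 
      ennreal (indicator {0..} t * indicator {0..} u * t powr ((l - n) / 2 - 1) * u powr (s / 2 - 1)
      * (u + t) powr (- (m / 2)) * exp (- (u * t / (u + t) * (norm v)\<^sup>2))) \<partial>lborel \<partial>lborel)"
    by (simp add: nn_integral_cmult)
  also have "\<dots> = ennreal (pi powr ((n + m) / 2)) * ennreal (Gamma ((l - n) / 2 + s / 2 - m / 2) *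
      Gamma (m / 2 - (l - n) / 2) * Gamma (m / 2 - s / 2) / Gamma (2 * (m / 2) - (l - n) / 2 - s / 2)
      * (norm v)\<^sup>2 powr (- ((l - n) / 2 + s / 2 - m / 2)))"
    using v l s ls by (subst nn_integral_gaussian_parameters) (auto simp: n_def m_def field_simps)
  also have "(norm v)\<^sup>2 powr (- ((l - n) / 2 + s / 2 - m / 2)) = norm v powr (n + m - l - s)"
  proof -
    have sq: "(norm v)\<^sup>2 powr y = norm v powr (2 * y)" for y
      using v by (simp add: powr_powr flip: powr_numeral)
    have "2 * - ((l - n) / 2 + s / 2 - m / 2) = n + m - l - s" by (simp add: field_simps)
    then show ?thesis
      by (simp only: sq)
  qed
  also have "ennreal c * (ennreal (pi powr ((n + m) / 2)) * ennreal (Gamma ((l - n) / 2 + s / 2 - m / 2) *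
      Gamma (m / 2 - (l - n) / 2) * Gamma (m / 2 - s / 2) / Gamma (2 * (m / 2) - (l - n) / 2 - s / 2)
      * norm v powr (n + m - l - s)))
    = ennreal (riesz_const DIM('a) DIM('b) l s * norm v powr (real (DIM('a) + DIM('b)) - l - s))"
  proof -
    have e: "(l - n) / 2 + s / 2 - m / 2 = (l + s - n - m) / 2" "m / 2 - (l - n) / 2 = (n + m - l) / 2"
      "m / 2 - s / 2 = (m - s) / 2" "2 * (m / 2) - (l - n) / 2 - s / 2 = (n + 2 * m - l - s) / 2"
      by (auto simp: field_simps)
    show ?thesis
      unfolding e unfolding riesz_const_def c_def n_def m_def
      by (subst ennreal_mult'[symmetric], simp, subst ennreal_mult'[symmetric])
        (use G in \<open>auto simp: mult_ac\<close>)
  qed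
  finally show ?thesis .
qed

section \<open>Schur's test\<close>

text \<open>Young's inequality for \<open>u = (t h) (u / (t h))\<close>. The free parameter \<open>t\<close> is what later turns the sum
  of two integrals into Hoelder's product. Where \<open>k\<close> vanishes, \<open>h\<close> may vanish too.\<close>

lemma weighted_young_le:
  fixes k u h :: real and p q t :: real
  assumes p: "1 < p" and q: "1 / p + 1 / q = 1" and t: "t > 0"
    and nn: "k \<ge> 0" "u \<ge> 0" and pos: "k > 0 \<Longrightarrow> h > 0"
  shows "k * u \<le> t powr q / q * (k * h powr q) + t powr (- p) / p * (k * (u powr p * h powr (- p)))"
proof (cases "k = 0")
  case False
  then have k: "k > 0" and h: "h > 0" using nn pos by auto
  have "q > 1" using p q by (smt (verit) divide_pos_neg divide_self_if frac_le le_divide_eq_1_pos less_divide_eq_1_pos zero_less_divide_1_iff)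
  then have "(u / (t * h)) * (t * h) \<le> (u / (t * h)) powr p / p + (t * h) powr q / q"
    using p q t h nn by (intro Youngs_inequality) auto
  also have "(u / (t * h)) * (t * h) = u" using t h by simp
  also have "(u / (t * h)) powr p / p + (t * h) powr q / q
      = t powr q / q * h powr q + t powr (- p) / p * (u powr p * h powr (- p))"
    using t h nn by (simp add: powr_divide powr_mult powr_minus field_simps)
  finally have "k * u \<le> k * (t powr q / q * h powr q + t powr (- p) / p * (u powr p * h powr (- p)))"
    using k by (intro mult_left_mono) auto
  then show ?thesis by (simp add: algebra_simps)
qed auto

lemma nn_integral_weighted_young:
  fixes k F h :: "'a \<Rightarrow> real"
  assumes p: "1 < p" and q: "1 / p + 1 / q = 1" and t: "t > 0"
    and [measurable]: "k \<in> borel_measurable M" "F \<in> borel_measurable M" "h \<in> borel_measurable M"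
    and nn: "\<And>y. k y \<ge> 0" "\<And>y. F y \<ge> 0" and pos: "\<And>y. k y > 0 \<Longrightarrow> h y > 0"
  shows "(\<integral>\<^sup>+y. ennreal (k y * F y) \<partial>M)
    \<le> ennreal (t powr q / q) * (\<integral>\<^sup>+y. ennreal (k y * h y powr q) \<partial>M)
      + ennreal (t powr (- p) / p) * (\<integral>\<^sup>+y. ennreal (k y * (F y powr p * h y powr (- p))) \<partial>M)"
proof -
  have q0: "q > 0" using p q by (smt (verit) divide_nonneg_nonpos divide_less_eq_1_pos)
  have "(\<integral>\<^sup>+y. ennreal (k y * F y) \<partial>M)
    \<le> (\<integral>\<^sup>+y. ennreal (t powr q / q) * ennreal (k y * h y powr q)
      + ennreal (t powr (- p) / p) * ennreal (k y * (F y powr p * h y powr (- p))) \<partial>M)"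
    using p q0 nn weighted_young_le[OF p q t nn pos]
    by (intro nn_integral_mono) (simp flip: ennreal_mult ennreal_plus)
  also have "\<dots> = ennreal (t powr q / q) * (\<integral>\<^sup>+y. ennreal (k y * h y powr q) \<partial>M)
      + ennreal (t powr (- p) / p) * (\<integral>\<^sup>+y. ennreal (k y * (F y powr p * h y powr (- p))) \<partial>M)"
    by (simp add: nn_integral_add nn_integral_cmult)
  finally show ?thesis .
qed

text \<open>Hoelder's inequality \<open>\<integral> k F \<le> (\<integral> k h\<^sup>q)\<^sup>1\<^sup>/\<^sup>q (\<integral> k F\<^sup>p h\<^sup>-\<^sup>p)\<^sup>1\<^sup>/\<^sup>p\<close>, raised to the power \<open>p\<close>. A real lower
  bound \<open>a\<close> of the left-hand side stands in for it because real powers are taken of reals only.\<close>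

lemma powr_le_nn_integral_Hoelder:
  fixes k F h :: "'a \<Rightarrow> real"
  assumes p: "1 < p" and q: "1 / p + 1 / q = 1"
    and meas[measurable]: "k \<in> borel_measurable M" "F \<in> borel_measurable M" "h \<in> borel_measurable M"
    and nn: "\<And>y. k y \<ge> 0" "\<And>y. F y \<ge> 0" and pos: "\<And>y. k y > 0 \<Longrightarrow> h y > 0"
    and A: "A > 0" "(\<integral>\<^sup>+y. ennreal (k y * h y powr q) \<partial>M) \<le> ennreal A"
    and a: "a \<ge> 0" "ennreal a \<le> (\<integral>\<^sup>+y. ennreal (k y * F y) \<partial>M)"
  shows "ennreal (a powr p)
    \<le> ennreal (A powr (p - 1)) * (\<integral>\<^sup>+y. ennreal (k y * (F y powr p * h y powr (- p))) \<partial>M)"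
    (is "_ \<le> _ * ?B")
proof (cases "?B = \<infinity>")
  case True
  then show ?thesis using A by (simp add: ennreal_mult_top)
next
  case False
  then obtain B where B: "B \<ge> 0" "?B = ennreal B" by (cases ?B) auto
  have q1: "q = p / (p - 1)" using p q by (cases "q = 0") (auto simp: field_simps)
  have q0: "q > 0" using p by (simp add: q1)
  \<comment> \<open>\<open>B\<close> itself may be \<open>0\<close>, and then no optimal \<open>t > 0\<close> exists.\<close>
  have "a powr p \<le> A powr (p - 1) * B'" if B': "B' > B" for B'
  proof -
    have B'0: "B' > 0" using B B' by simp
    \<comment> \<open>The minimizer of the right-hand side of the weighted Young inequality: it makes both terms
      equal up to the factors \<open>1/q\<close> and \<open>1/p\<close>.\<close>
    define t where "t = (B' / A) powr (1 / (p * q))"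
    have t: "t > 0" using A B'0 by (simp add: t_def)
    have e: "1 / (p * q) * q = 1 / p" "1 / (p * q) * (- p) = 1 / p - 1"
      using p q q0 by (auto simp: field_simps)
    have tq: "t powr q * A = B' powr (1 / p) * A powr (1 - 1 / p)"
      unfolding t_def powr_powr e using A B'0 by (simp add: powr_divide powr_diff)
    have tp: "t powr (- p) * B' = B' powr (1 / p) * A powr (1 - 1 / p)"
      unfolding t_def powr_powr e using A B'0 by (simp add: powr_divide powr_diff)
    have "ennreal a \<le> ennreal (t powr q / q) * ennreal A + ennreal (t powr (- p) / p) * ennreal B'"
      using A B B' by (intro order.trans[OF a(2)]
          order.trans[OF nn_integral_weighted_young[OF p q t meas nn pos]] add_mono mult_left_mono)
        (auto simp: ennreal_leI)
    also have "\<dots> = ennreal (t powr q / q * A + t powr (- p) / p * B')"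
      using p q0 A B'0 by (simp flip: ennreal_mult ennreal_plus)
    finally have "a \<le> t powr q / q * A + t powr (- p) / p * B'"
      using p q0 A B'0 by (subst (asm) ennreal_le_iff) auto
    also have "\<dots> = (t powr q * A) * (1 / q) + (t powr (- p) * B') * (1 / p)" by simp
    also have "\<dots> = B' powr (1 / p) * A powr (1 - 1 / p) * (1 / p + 1 / q)"
      unfolding tq tp by (simp add: algebra_simps)
    also have "\<dots> = B' powr (1 / p) * A powr (1 - 1 / p)" by (simp add: q)
    finally have "a powr p \<le> (B' powr (1 / p) * A powr (1 - 1 / p)) powr p"
      using a p by (intro powr_mono2) auto
    also have "\<dots> = A powr (p - 1) * B'"
      using p A B'0 by (simp add: powr_mult powr_powr algebra_simps)
    finally show ?thesis .
  qed
  then have "a powr p / A powr (p - 1) \<le> B'" if "B' > B" for B'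
    using A that by (simp add: field_simps)
  then have "a powr p / A powr (p - 1) \<le> B" by (rule dense_ge)
  then have "a powr p \<le> A powr (p - 1) * B" using A by (simp add: field_simps)
  then show ?thesis unfolding B using B by (simp add: ennreal_leI flip: ennreal_mult)
qed

text \<open>Schur's test in the form with two weights. Positivity of the weights is required only where the
  kernel is positive, so that weights and kernel may vanish together on the exceptional set
  \<open>v = 0\<close>.\<close>

locale schur_kernel = M: sigma_finite_measure M + N: sigma_finite_measure N
  for M :: "'a measure" and N :: "'b measure" +
  fixes K :: "'a \<Rightarrow> 'b \<Rightarrow> real" and g :: "'a \<Rightarrow> real" and h :: "'b \<Rightarrow> real" and p q C :: real
  assumes p: "1 < p" and q: "1 / p + 1 / q = 1" and C: "C > 0"
    and measurable_K [measurable]: "case_prod K \<in> borel_measurable (M \<Otimes>\<^sub>M N)"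
    and measurable_g [measurable]: "g \<in> borel_measurable M"
    and measurable_h [measurable]: "h \<in> borel_measurable N"
    and K_nonneg: "\<And>x y. K x y \<ge> 0"
    and weights_pos: "\<And>x y. K x y > 0 \<Longrightarrow> g x > 0 \<and> h y > 0"
    and row: "\<And>x. (\<integral>\<^sup>+y. ennreal (K x y * h y powr q) \<partial>N) \<le> ennreal (C * g x powr q)"
    and col: "\<And>y. (\<integral>\<^sup>+x. ennreal (K x y * g x powr p) \<partial>M) \<le> ennreal (C * h y powr p)"
begin

sublocale pair_sigma_finite M N ..

text \<open>Tonelli's theorem and the column bound. The factor \<open>h\<^sup>p\<close> from the column bound cancels \<open>h\<^sup>-\<^sup>p\<close>.\<close>

lemma dual_bound:
  assumes [measurable]: "F \<in> borel_measurable N" and F: "\<And>y. F y \<ge> 0"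
  shows "(\<integral>\<^sup>+x. ennreal (g x powr p) * (\<integral>\<^sup>+y. ennreal (K x y * (F y powr p * h y powr (- p))) \<partial>N) \<partial>M)
    \<le> ennreal C * (\<integral>\<^sup>+y. ennreal (F y powr p) \<partial>N)"
proof -
  have "(\<integral>\<^sup>+x. ennreal (g x powr p) * (\<integral>\<^sup>+y. ennreal (K x y * (F y powr p * h y powr (- p))) \<partial>N) \<partial>M)
    = (\<integral>\<^sup>+x. \<integral>\<^sup>+y. ennreal (g x powr p * (K x y * (F y powr p * h y powr (- p)))) \<partial>N \<partial>M)"
    by (intro nn_integral_cong) (simp add: nn_integral_cmult ennreal_mult K_nonneg)
  also have "\<dots> = (\<integral>\<^sup>+y. \<integral>\<^sup>+x. ennreal (g x powr p * (K x y * (F y powr p * h y powr (- p)))) \<partial>M \<partial>N)"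
    by (rule Fubini'[symmetric]) measurable
  also have "\<dots> \<le> (\<integral>\<^sup>+y. ennreal C * ennreal (F y powr p) \<partial>N)"
  proof (intro nn_integral_mono)
    fix y assume [measurable]: "y \<in> space N"
    have "(\<integral>\<^sup>+x. ennreal (g x powr p * (K x y * (F y powr p * h y powr (- p)))) \<partial>M)
      = (\<integral>\<^sup>+x. ennreal (F y powr p * h y powr (- p)) * ennreal (K x y * g x powr p) \<partial>M)"
      by (intro nn_integral_cong) (simp add: K_nonneg mult_ac flip: ennreal_mult)
    also have "\<dots> = ennreal (F y powr p * h y powr (- p)) * (\<integral>\<^sup>+x. ennreal (K x y * g x powr p) \<partial>M)"
      by (intro nn_integral_cmult) measurable
    also have "\<dots> \<le> ennreal (F y powr p * h y powr (- p)) * ennreal (C * h y powr p)"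
      by (intro mult_left_mono col) auto
    also have "\<dots> = ennreal (F y powr p * (h y powr (- p) * h y powr p) * C)"
      using C by (simp add: mult_ac flip: ennreal_mult)
    also have "\<dots> \<le> ennreal (F y powr p * 1 * C)"
      using C by (intro ennreal_leI mult_right_mono mult_left_mono) (auto simp flip: powr_add)
    also have "\<dots> = ennreal C * ennreal (F y powr p)"
      using C by (simp add: mult.commute flip: ennreal_mult)
    finally show "(\<integral>\<^sup>+x. ennreal (g x powr p * (K x y * (F y powr p * h y powr (- p)))) \<partial>M)
      \<le> ennreal C * ennreal (F y powr p)" .
  qed
  also have "\<dots> = ennreal C * (\<integral>\<^sup>+y. ennreal (F y powr p) \<partial>N)"
    by (intro nn_integral_cmult) auto
  finally show ?thesis .
qed

text \<open>Hoelder's inequality and the row bound give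
  \<open>T(x)\<^sup>p \<le> (C g(x)\<^sup>q)\<^sup>p\<^sup>-\<^sup>1 \<integral> K F\<^sup>p h\<^sup>-\<^sup>p\<close>, where \<open>q (p - 1) = p\<close>; integrating over \<open>x\<close> reduces the
  claim to \<open>dual_bound\<close>.\<close>

lemma schur_bound:
  assumes [measurable]: "F \<in> borel_measurable N" and F: "\<And>y. F y \<ge> 0" and T: "\<And>x. T x \<ge> 0"
    and le: "\<And>x. x \<in> space M \<Longrightarrow> ennreal (T x) \<le> (\<integral>\<^sup>+y. ennreal (K x y * F y) \<partial>N)"
  shows "(\<integral>\<^sup>+x. ennreal (T x powr p) \<partial>M) \<le> ennreal (C powr p) * (\<integral>\<^sup>+y. ennreal (F y powr p) \<partial>N)"
proof -
  let ?B = "\<lambda>x. \<integral>\<^sup>+y. ennreal (K x y * (F y powr p * h y powr (- p))) \<partial>N"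
  have qp: "q * (p - 1) = p" using p q by (cases "q = 0") (auto simp: field_simps)
  have "(\<integral>\<^sup>+x. ennreal (T x powr p) \<partial>M) \<le> (\<integral>\<^sup>+x. ennreal (C powr (p - 1)) * (ennreal (g x powr p) * ?B x) \<partial>M)"
  proof (intro nn_integral_mono)
    fix x assume x[measurable]: "x \<in> space M"
    show "ennreal (T x powr p) \<le> ennreal (C powr (p - 1)) * (ennreal (g x powr p) * ?B x)"
    proof (cases "g x > 0")
      case True
      have "ennreal (T x powr p) \<le> ennreal ((C * g x powr q) powr (p - 1)) * ?B x"
        using p q F K_nonneg weights_pos T le[OF x] row[of x] C True
        by (intro powr_le_nn_integral_Hoelder[where q = q]) auto
      also have "(C * g x powr q) powr (p - 1) = C powr (p - 1) * g x powr p"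
        using C by (simp add: powr_mult powr_powr qp)
      finally show ?thesis by (simp add: ennreal_mult mult.assoc)
    next
      case False
      then have "K x y = 0" for y using weights_pos[of x y] K_nonneg[of x y] by fastforce
      then have "T x = 0" using le[OF x] T[of x] by simp
      then show ?thesis using p by simp
    qed
  qed
  also have "\<dots> = ennreal (C powr (p - 1)) * (\<integral>\<^sup>+x. ennreal (g x powr p) * ?B x \<partial>M)"
    by (intro nn_integral_cmult) measurable
  also have "\<dots> \<le> ennreal (C powr (p - 1)) * (ennreal C * (\<integral>\<^sup>+y. ennreal (F y powr p) \<partial>N))"
    by (intro mult_left_mono dual_bound F) auto
  also have "\<dots> = ennreal (C powr p) * (\<integral>\<^sup>+y. ennreal (F y powr p) \<partial>N)"
    using C by (simp add: mult.assoc[symmetric] powr_diff flip: ennreal_mult)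
  finally show ?thesis .
qed

text \<open>By \<open>dual_bound\<close> the integral \<open>\<integral> K F\<^sup>p h\<^sup>-\<^sup>p\<close> is finite for almost every \<open>x\<close> with \<open>g(x) > 0\<close>; the weighted
  Young inequality with \<open>t = 1\<close> then makes \<open>\<integral> K F\<close> finite. Where \<open>g\<close> vanishes, so does \<open>K\<close>.\<close>

lemma AE_nn_integral_finite:
  assumes [measurable]: "F \<in> borel_measurable N" and F: "\<And>y. F y \<ge> 0"
    and fin: "(\<integral>\<^sup>+y. ennreal (F y powr p) \<partial>N) < \<infinity>"
  shows "AE x in M. (\<integral>\<^sup>+y. ennreal (K x y * F y) \<partial>N) < \<infinity>"
proof -
  let ?B = "\<lambda>x. \<integral>\<^sup>+y. ennreal (K x y * (F y powr p * h y powr (- p))) \<partial>N"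
  have "(\<integral>\<^sup>+x. ennreal (g x powr p) * ?B x \<partial>M) < \<infinity>"
    by (rule le_less_trans[OF dual_bound]) (use F fin in \<open>auto simp: ennreal_mult_less_top\<close>)
  then have "AE x in M. ennreal (g x powr p) * ?B x \<noteq> \<infinity>"
    by (intro nn_integral_PInf_AE) auto
  with AE_space show ?thesis
  proof eventually_elim
    fix x assume x[measurable]: "x \<in> space M" and "ennreal (g x powr p) * ?B x \<noteq> \<infinity>"
    show "(\<integral>\<^sup>+y. ennreal (K x y * F y) \<partial>N) < \<infinity>"
    proof (cases "g x > 0")
      case True
      with \<open>ennreal (g x powr p) * ?B x \<noteq> \<infinity>\<close> have "?B x < \<infinity>"
        by (auto simp: ennreal_mult_eq_top_iff top.not_eq_extremum)
      moreover have "(\<integral>\<^sup>+y. ennreal (K x y * h y powr q) \<partial>N) < \<infinity>"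
        using row[of x] by (rule le_less_trans) simp
      moreover have "(\<integral>\<^sup>+y. ennreal (K x y * F y) \<partial>N)
          \<le> ennreal (1 powr q / q) * (\<integral>\<^sup>+y. ennreal (K x y * h y powr q) \<partial>N)
            + ennreal (1 powr (- p) / p) * ?B x"
        using p q F K_nonneg weights_pos by (intro nn_integral_weighted_young) auto
      ultimately show ?thesis
        by (elim le_less_trans) (auto simp: ennreal_mult_less_top)
    next
      case False
      then have "K x y = 0" for y using weights_pos[of x y] K_nonneg[of x y] by fastforce
      then show ?thesis by simp
    qed
  qed
qed

end

section \<open>The weighted Riesz potential\<close>

definition stein_weiss_kernel ::
    "real \<Rightarrow> real \<Rightarrow> real \<Rightarrow> (real ^ 'n) \<times> (real ^ 'm) \<Rightarrow> (real ^ 'n) \<times> (real ^ 'm) \<Rightarrow> real" where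
  "stein_weiss_kernel l \<alpha> \<beta> w w' =
     norm (snd w) powr (- \<alpha>) * (riesz_kernel l (w - w') * norm (snd w') powr (- \<beta>))"

lemma borel_measurable_norm_snd_powr [measurable]:
  "(\<lambda>w :: 'a::euclidean_space \<times> 'b::euclidean_space. norm (snd w) powr c) \<in> borel_measurable borel"
proof -
  have [measurable]: "(\<lambda>w :: 'a \<times> 'b. norm (snd w)) \<in> borel_measurable borel"
    by (intro borel_measurable_continuous_onI continuous_intros)
  show ?thesis by measurable
qed

lemma borel_measurable_riesz_kernel [measurable]: "riesz_kernel l \<in> borel_measurable borel"
  unfolding riesz_kernel_def by measurable

text \<open>The row bound for the weight power \<open>|v|\<^sup>-\<^sup>s\<close>. The factor \<open>|v'|\<^sup>-\<^sup>\<beta>\<close> joins the weight, and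
  \<open>N = l + \<alpha> + \<beta>\<close> makes the resulting power \<open>|v|\<^sup>-\<^sup>\<alpha>\<^sup>+\<^sup>N\<^sup>-\<^sup>l\<^sup>-\<^sup>\<beta>\<^sup>-\<^sup>s\<close> equal to \<open>|v|\<^sup>-\<^sup>s\<close> again. On the set \<open>v = 0\<close>
  the kernel is \<open>0\<close> by the convention for \<open>powr\<close>.\<close>

lemma nn_integral_stein_weiss_kernel_le:
  fixes w :: "(real ^ 'n) \<times> (real ^ 'm)" and l \<alpha> \<beta> s :: real
  defines "N \<equiv> real (CARD('n) + CARD('m))"
  assumes l: "l < N" and s: "\<beta> + s < CARD('m)" and ls: "N < l + \<beta> + s"
    and hom: "N = l + \<alpha> + \<beta>" and C: "riesz_const CARD('n) CARD('m) l (\<beta> + s) = C" "C \<ge> 0"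
  shows "(\<integral>\<^sup>+w'. ennreal (stein_weiss_kernel l \<alpha> \<beta> w w' * norm (snd w') powr (- s)) \<partial>lborel)
    \<le> ennreal (C * norm (snd w) powr (- s))"
proof (cases "snd w = 0")
  case True
  then show ?thesis by (simp add: stein_weiss_kernel_def)
next
  case False
  have "(\<integral>\<^sup>+w'. ennreal (stein_weiss_kernel l \<alpha> \<beta> w w' * norm (snd w') powr (- s)) \<partial>lborel)
    = (\<integral>\<^sup>+w'. ennreal (norm (snd w) powr (- \<alpha>)) *
        ennreal (norm ((fst w, snd w) - w') powr (- l) * norm (snd w') powr (- (\<beta> + s))) \<partial>lborel)"
  proof (intro nn_integral_cong)
    fix w' :: "(real ^ 'n) \<times> (real ^ 'm)"
    have "norm (snd w') powr (- \<beta>) * norm (snd w') powr (- s) = norm (snd w') powr (- (\<beta> + s))"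
      unfolding powr_add[symmetric] by (simp add: algebra_simps)
    then show "ennreal (stein_weiss_kernel l \<alpha> \<beta> w w' * norm (snd w') powr (- s))
      = ennreal (norm (snd w) powr (- \<alpha>)) *
        ennreal (norm ((fst w, snd w) - w') powr (- l) * norm (snd w') powr (- (\<beta> + s)))"
      by (simp add: stein_weiss_kernel_def riesz_kernel_def mult.assoc flip: ennreal_mult')
  qed
  also have "\<dots> = ennreal (norm (snd w) powr (- \<alpha>)) * (\<integral>\<^sup>+w'.
        ennreal (norm ((fst w, snd w) - w') powr (- l) * norm (snd w') powr (- (\<beta> + s))) \<partial>lborel)"
    by (intro nn_integral_cmult) measurable
  also have "\<dots> \<le> ennreal (norm (snd w) powr (- \<alpha>)) *
      ennreal (C * norm (snd w) powr (N - l - (\<beta> + s)))"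
    using nn_integral_riesz_kernel_weight_le[of "snd w" l "\<beta> + s" "fst w"] False l s ls C
    by (intro mult_left_mono) (auto simp: N_def)
  also have "\<dots> = ennreal (C * (norm (snd w) powr (- \<alpha>) * norm (snd w) powr (N - l - (\<beta> + s))))"
    using C by (simp add: mult_ac flip: ennreal_mult)
  also have "norm (snd w) powr (- \<alpha>) * norm (snd w) powr (N - l - (\<beta> + s)) = norm (snd w) powr (- s)"
    unfolding powr_add[symmetric] by (simp add: hom)
  finally show ?thesis .
qed

text \<open>The rows use \<open>s = m/p\<close>. Exchanging \<open>w\<close> and \<open>w'\<close> turns the kernel into the one with \<open>\<alpha>\<close> and \<open>\<beta>\<close>
  exchanged, so the columns are rows of that kernel, with \<open>s = m/p'\<close>. The constant \<open>G\<^sub>\<alpha>\<^sub>\<beta>\<close> is invariant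
  under exchanging \<open>(\<alpha>, p)\<close> with \<open>(\<beta>, p')\<close>, so both bounds have the same constant.\<close>

lemma schur_kernel_stein_weiss:
  fixes p p' l \<alpha> \<beta> :: real and n m :: nat
  assumes n: "n = CARD('n)" and m: "m = CARD('m)"
    and p: "1 < p" and q: "1 / p + 1 / p' = 1"
    and l: "0 < l" "l < real (n + m)"
    and \<alpha>: "\<alpha> < real m / p" and \<beta>: "\<beta> < real m / p'"
    and hom: "real (n + m) = l + \<alpha> + \<beta>"
  defines "h \<equiv> \<lambda>w :: (real ^ 'n) \<times> (real ^ 'm). norm (snd w) powr (- (m / (p * p')))"
  shows "schur_kernel lborel lborel (stein_weiss_kernel l \<alpha> \<beta>) h h p p' (G_const n m p p' \<alpha> \<beta>)"
proof -
  have p'0: "p' > 0" using p q by (smt (verit) divide_nonneg_nonpos divide_less_eq_1_pos)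
  have mm: "m / p + m / p' = m" using q by (metis (no_types) distrib_left mult.right_neutral times_divide_eq_right)
  define a b where "a = m / p" and "b = m / p'"
  have ab: "m / (2 * p) = a / 2" "m / (2 * p') = b / 2" "m / p = a" "m / p' = b"
    by (simp_all add: a_def b_def)
  have hom': "real n + real m = l + \<alpha> + \<beta>" "a + b = m" using hom mm by (simp_all add: ab)
  define G where "G = G_const n m p p' \<alpha> \<beta>"
  have args: "(\<alpha> + \<beta>) / 2 > 0" "m / (2 * p) - \<alpha> / 2 > 0" "m / (2 * p') - \<beta> / 2 > 0"
    "(real (n + m) - \<alpha> - \<beta>) / 2 > 0" "m / (2 * p') + \<alpha> / 2 > 0" "m / (2 * p) + \<beta> / 2 > 0"
    using p p'0 l \<alpha> \<beta> hom mm by auto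
  have G0: "G > 0"
    using args[THEN Gamma_real_pos] by (simp add: G_def G_const_def)
  have C1: "riesz_const n m l (\<beta> + m / p) = G"
  proof -
    have e: "(l + (\<beta> + m / p) - real n - real m) / 2 = m / (2 * p) - \<alpha> / 2" "(real n + real m - l) / 2 = (\<alpha> + \<beta>) / 2"
      "(m - (\<beta> + m / p)) / 2 = m / (2 * p') - \<beta> / 2" "l / 2 = (real (n + m) - \<alpha> - \<beta>) / 2"
      "(\<beta> + m / p) / 2 = m / (2 * p) + \<beta> / 2" "(real n + 2 * real m - l - (\<beta> + m / p)) / 2 = m / (2 * p') + \<alpha> / 2"
      unfolding ab of_nat_add of_nat_mult using hom' by (simp_all add: field_simps)
    show ?thesis
      unfolding riesz_const_def G_def G_const_def e by (simp add: mult_ac)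
  qed
  have C2: "riesz_const n m l (\<alpha> + m / p') = G"
  proof -
    have e: "(l + (\<alpha> + m / p') - real n - real m) / 2 = m / (2 * p') - \<beta> / 2" "(real n + real m - l) / 2 = (\<alpha> + \<beta>) / 2"
      "(m - (\<alpha> + m / p')) / 2 = m / (2 * p) - \<alpha> / 2" "l / 2 = (real (n + m) - \<alpha> - \<beta>) / 2"
      "(\<alpha> + m / p') / 2 = m / (2 * p') + \<alpha> / 2" "(real n + 2 * real m - l - (\<alpha> + m / p')) / 2 = m / (2 * p) + \<beta> / 2"
      unfolding ab of_nat_add of_nat_mult using hom' by (simp_all add: field_simps)
    show ?thesis
      unfolding riesz_const_def G_def G_const_def e by (simp add: mult_ac)
  qed
  have hq: "h w powr p' = norm (snd w) powr (- (m / p))"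
    and hp: "h w powr p = norm (snd w) powr (- (m / p'))" for w
    using p p'0 by (simp_all add: h_def powr_powr)
  show ?thesis
    unfolding G_def[symmetric]
  proof unfold_locales
    have "(\<lambda>(w, w'). stein_weiss_kernel l \<alpha> \<beta> w w') \<in> borel_measurable
        (borel \<Otimes>\<^sub>M borel :: (((real ^ 'n) \<times> (real ^ 'm)) \<times> ((real ^ 'n) \<times> (real ^ 'm))) measure)"
      unfolding stein_weiss_kernel_def by measurable
    then show "case_prod (stein_weiss_kernel l \<alpha> \<beta>) \<in> borel_measurable
        (lborel \<Otimes>\<^sub>M lborel :: (((real ^ 'n) \<times> (real ^ 'm)) \<times> ((real ^ 'n) \<times> (real ^ 'm))) measure)"
      by simp
  next
    fix w w' :: "(real ^ 'n) \<times> (real ^ 'm)"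
    assume "stein_weiss_kernel l \<alpha> \<beta> w w' > 0"
    then show "h w > 0 \<and> h w' > 0" by (auto simp: stein_weiss_kernel_def h_def)
  next
    fix w :: "(real ^ 'n) \<times> (real ^ 'm)"
    show "(\<integral>\<^sup>+w'. ennreal (stein_weiss_kernel l \<alpha> \<beta> w w' * h w' powr p') \<partial>lborel)
        \<le> ennreal (G * h w powr p')"
      unfolding hq using l \<alpha> \<beta> hom mm C1 G0
      by (intro nn_integral_stein_weiss_kernel_le) (auto simp: n m)
  next
    fix w' :: "(real ^ 'n) \<times> (real ^ 'm)"
    have "(\<integral>\<^sup>+w. ennreal (stein_weiss_kernel l \<alpha> \<beta> w w' * norm (snd w) powr (- (m / p'))) \<partial>lborel)
      = (\<integral>\<^sup>+w. ennreal (stein_weiss_kernel l \<beta> \<alpha> w' w * norm (snd w) powr (- (m / p'))) \<partial>lborel)"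
      by (simp add: stein_weiss_kernel_def riesz_kernel_def norm_minus_commute mult_ac)
    also have "\<dots> \<le> ennreal (G * norm (snd w') powr (- (m / p')))"
      using l \<alpha> \<beta> hom mm C2 G0
      by (intro nn_integral_stein_weiss_kernel_le) (auto simp: n m)
    finally show "(\<integral>\<^sup>+w. ennreal (stein_weiss_kernel l \<alpha> \<beta> w w' * h w powr p) \<partial>lborel)
        \<le> ennreal (G * h w' powr p)"
      unfolding hp .
  qed (use p q G0 in \<open>auto simp: h_def stein_weiss_kernel_def riesz_kernel_def\<close>)
qed

lemma borel_version_of_lebesgue_measurable:
  fixes f :: "'a::euclidean_space \<Rightarrow> complex"
  assumes f: "f \<in> borel_measurable lebesgue"
  obtains g where "g \<in> borel_measurable borel" "AE w in lebesgue. f w = g w"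
proof -
  have "(\<lambda>w. Re (f w)) \<in> borel_measurable lebesgue" "(\<lambda>w. Im (f w)) \<in> borel_measurable lebesgue"
    using f by measurable
  then obtain u v where [measurable]: "u \<in> borel_measurable lborel" "v \<in> borel_measurable lborel"
    and uv: "AE w in lborel. Re (f w) = u w" "AE w in lborel. Im (f w) = v w"
    using completion_ex_borel_measurable_real by metis
  show ?thesis
  proof
    show "(\<lambda>w. Complex (u w) (v w)) \<in> borel_measurable borel"
      unfolding Complex_eq by simp
    have "AE w in lborel. f w = Complex (u w) (v w)"
      using uv by eventually_elim (simp add: complex_eq_iff)
    then show "AE w in lebesgue. f w = Complex (u w) (v w)"
      by (rule AE_completion)
  qed
qed

text \<open>For Borel \<open>f\<close> the integrands are Borel, so Lebesgue and Borel-Lebesgue integrals agree and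
  Schur's test applies to \<open>|f|\<close>. It dominates the operator pointwise, also at points where the
  convolution diverges and is \<open>0\<close> by convention.\<close>

lemma stein_weiss_borel:
  fixes p p' l \<alpha> \<beta> :: real and n m :: nat
    and f :: "(real ^ 'n) \<times> (real ^ 'm) \<Rightarrow> complex"
  assumes "n = CARD('n)" and "m = CARD('m)"
    and p: "1 < p" and "1 / p + 1 / p' = 1"
    and "0 < l" and "l < real (n + m)"
    and "\<alpha> < real m / p" and "\<beta> < real m / p'"
    and "real (n + m) = l + \<alpha> + \<beta>"
    and f[measurable]: "f \<in> borel_measurable borel" and Lp: "in_Lp p lebesgue f"
  shows "(AE w in lebesgue. convolution_exists_at (riesz_kernel l) (weighted \<beta> f) w)
    \<and> in_Lp p lebesgue (weighted \<alpha> (convolution (riesz_kernel l) (weighted \<beta> f)))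
    \<and> Lp_norm p lebesgue (weighted \<alpha> (convolution (riesz_kernel l) (weighted \<beta> f)))
        \<le> G_const n m p p' \<alpha> \<beta> * Lp_norm p lebesgue f"
proof -
  interpret schur_kernel lborel lborel "stein_weiss_kernel l \<alpha> \<beta>"
    "\<lambda>w :: (real ^ 'n) \<times> (real ^ 'm). norm (snd w) powr (- (m / (p * p')))"
    "\<lambda>w :: (real ^ 'n) \<times> (real ^ 'm). norm (snd w) powr (- (m / (p * p')))" p p' "G_const n m p p' \<alpha> \<beta>"
    using assms by (intro schur_kernel_stein_weiss) auto
  let ?I = "\<lambda>w w'. riesz_kernel l (w - w') *\<^sub>R weighted \<beta> f w'"
  let ?T = "weighted \<alpha> (convolution (riesz_kernel l) (weighted \<beta> f))"
  have [measurable]: "weighted \<beta> f \<in> borel_measurable borel"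
    unfolding weighted_def by measurable
  have I[measurable]: "?I w \<in> borel_measurable borel" for w by measurable
  have conv: "convolution (riesz_kernel l) (weighted \<beta> f) w = (\<integral>w'. ?I w w' \<partial>lborel)" for w
    unfolding convolution_def by (rule integral_completion) simp
  have ex: "convolution_exists_at (riesz_kernel l) (weighted \<beta> f) w \<longleftrightarrow> integrable lborel (?I w)" for w
    unfolding convolution_exists_at_def by (rule integrable_completion) simp
  have T_eq: "?T w = norm (snd w) powr (- \<alpha>) *\<^sub>R (\<integral>w'. ?I w w' \<partial>lborel)" for w
    by (simp only: weighted_def[of \<alpha>] conv)
  have "(\<lambda>(w, w'). ?I w w') \<in> borel_measurable (lborel \<Otimes>\<^sub>M lborel)"
    by measurable
  then have "(\<lambda>w. \<integral>w'. ?I w w' \<partial>lborel) \<in> borel_measurable lborel"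
    by (rule lborel.borel_measurable_lebesgue_integral)
  then have T[measurable]: "?T \<in> borel_measurable borel"
    unfolding T_eq[abs_def] by simp
  have K: "ennreal (norm (snd w) powr (- \<alpha>)) * (\<integral>\<^sup>+w'. ennreal (norm (?I w w')) \<partial>lborel)
      = (\<integral>\<^sup>+w'. ennreal (stein_weiss_kernel l \<alpha> \<beta> w w' * norm (f w')) \<partial>lborel)" for w
    by (subst nn_integral_cmult[symmetric])
      (auto simp: stein_weiss_kernel_def weighted_def riesz_kernel_def mult_ac simp flip: ennreal_mult)
  have T_le: "ennreal (norm (?T w)) \<le> (\<integral>\<^sup>+w'. ennreal (stein_weiss_kernel l \<alpha> \<beta> w w' * norm (f w')) \<partial>lborel)" for w
  proof -
    have "ennreal (norm (\<integral>w'. ?I w w' \<partial>lborel)) \<le> (\<integral>\<^sup>+w'. ennreal (norm (?I w w')) \<partial>lborel)"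
    proof (cases "integrable lborel (?I w)")
      case True
      then show ?thesis by (rule integral_norm_bound_ennreal)
    qed (simp add: not_integrable_integral_eq)
    then show ?thesis
      unfolding K[symmetric] by (simp add: T_eq ennreal_mult mult_left_mono)
  qed
  have int_f: "integrable lebesgue (\<lambda>w. norm (f w) powr p)"
    using Lp by (simp add: in_Lp_def)
  then have nn_f: "(\<integral>\<^sup>+w. ennreal (norm (f w) powr p) \<partial>lborel) = ennreal (\<integral>w. norm (f w) powr p \<partial>lebesgue)"
    by (subst nn_integral_completion[symmetric]) (simp add: nn_integral_eq_integral)
  have bound: "(\<integral>\<^sup>+w. ennreal (norm (?T w) powr p) \<partial>lebesgue)
      \<le> ennreal (G_const n m p p' \<alpha> \<beta> powr p * (\<integral>w. norm (f w) powr p \<partial>lebesgue))"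
    unfolding nn_integral_completion
    using schur_bound[of "\<lambda>w. norm (f w)" "\<lambda>w. norm (?T w)"] T_le
    by (simp add: nn_f ennreal_mult)
  have int_T: "integrable lebesgue (\<lambda>w. norm (?T w) powr p)"
    using bound by (intro integrableI_bounded) (auto intro: le_less_trans measurable_completion)
  have "AE w in lborel. (\<integral>\<^sup>+w'. ennreal (stein_weiss_kernel l \<alpha> \<beta> w w' * norm (f w')) \<partial>lborel) < \<infinity>"
    by (intro AE_nn_integral_finite) (auto simp: nn_f)
  moreover have "AE w :: (real ^ 'n) \<times> (real ^ 'm) in lborel. snd w \<noteq> 0"
  proof -
    have "AE w :: (real ^ 'n) \<times> (real ^ 'm) in lborel \<Otimes>\<^sub>M lborel. snd w \<noteq> 0"
      by (rule lborel_pair.AE_pair_measure) (measurable, simp add: AE_lborel_singleton)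
    then show ?thesis by (simp only: lborel_prod)
  qed
  ultimately have "AE w in lborel. convolution_exists_at (riesz_kernel l) (weighted \<beta> f) w"
  proof eventually_elim
    case (elim w)
    then have "(\<integral>\<^sup>+w'. ennreal (norm (?I w w')) \<partial>lborel) < \<infinity>"
      unfolding K[symmetric] by (auto simp: ennreal_mult_less_top)
    then show ?case
      unfolding ex by (intro integrableI_bounded) auto
  qed
  then have "AE w in lebesgue. convolution_exists_at (riesz_kernel l) (weighted \<beta> f) w"
    by (rule AE_completion)
  moreover have "in_Lp p lebesgue ?T"
    using int_T T by (auto simp: in_Lp_def intro: measurable_completion)
  moreover have "Lp_norm p lebesgue ?T \<le> G_const n m p p' \<alpha> \<beta> * Lp_norm p lebesgue f"
  proof -
    have "(\<integral>w. norm (?T w) powr p \<partial>lebesgue) \<le> G_const n m p p' \<alpha> \<beta> powr p * (\<integral>w. norm (f w) powr p \<partial>lebesgue)"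
      using bound by (subst (asm) nn_integral_eq_integral[OF int_T]) auto
    then have "(\<integral>w. norm (?T w) powr p \<partial>lebesgue) powr (1 / p)
        \<le> (G_const n m p p' \<alpha> \<beta> powr p * (\<integral>w. norm (f w) powr p \<partial>lebesgue)) powr (1 / p)"
      using p by (intro powr_mono2) auto
    also have "\<dots> = G_const n m p p' \<alpha> \<beta> * (\<integral>w. norm (f w) powr p \<partial>lebesgue) powr (1 / p)"
      using p C by (simp add: powr_mult powr_powr)
    finally show ?thesis by (simp add: Lp_norm_def)
  qed
  ultimately show ?thesis by blast
qed

text \<open>Changing \<open>f\<close> on a null set changes neither its norm nor any of the integrals that define the
  convolution, so the Borel case suffices.\<close>

theorem theorem5:
  fixes p p' l \<alpha> \<beta> :: real and n m :: nat
    and f :: "(real ^ 'n) \<times> (real ^ 'm) \<Rightarrow> complex"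
  assumes "n = CARD('n)" and "m = CARD('m)"
    and "1 < p" and "1 / p + 1 / p' = 1"
    and "0 < l" and "l < real (n + m)"
    and "\<alpha> < real m / p" and "\<beta> < real m / p'"
    and "real (n + m) = l + \<alpha> + \<beta>"
    and "in_Lp p lebesgue f"
  shows "(AE w in lebesgue. convolution_exists_at (riesz_kernel l) (weighted \<beta> f) w)
    \<and> in_Lp p lebesgue (weighted \<alpha> (convolution (riesz_kernel l) (weighted \<beta> f)))
    \<and> Lp_norm p lebesgue (weighted \<alpha> (convolution (riesz_kernel l) (weighted \<beta> f)))
        \<le> G_const n m p p' \<alpha> \<beta> * Lp_norm p lebesgue f"
proof -
  have f: "f \<in> borel_measurable lebesgue" using assms(10) by (simp add: in_Lp_def)
  then obtain g where g[measurable]: "g \<in> borel_measurable borel" and fg: "AE w in lebesgue. f w = g w"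
    by (rule borel_version_of_lebesgue_measurable)
  have g': "g \<in> borel_measurable lebesgue" by (intro measurable_completion) simp
  have norm_eq: "(\<integral>w. norm (f w) powr p \<partial>lebesgue) = (\<integral>w. norm (g w) powr p \<partial>lebesgue)"
    using f g' fg by (intro integral_cong_AE) auto
  have "integrable lebesgue (\<lambda>w. norm (f w) powr p) \<longleftrightarrow> integrable lebesgue (\<lambda>w. norm (g w) powr p)"
    using f g' fg by (intro integrable_cong_AE) auto
  then have Lp: "in_Lp p lebesgue g"
    using assms(10) g' by (simp add: in_Lp_def)
  have wf: "(\<lambda>w'. riesz_kernel l (w - w') *\<^sub>R weighted \<beta> u w') \<in> borel_measurable lebesgue"
    if "u \<in> borel_measurable lebesgue" for w and u :: "(real ^ 'n) \<times> (real ^ 'm) \<Rightarrow> complex"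
  proof -
    have "(\<lambda>w'. riesz_kernel l (w - w')) \<in> borel_measurable lebesgue"
      "(\<lambda>w' :: (real ^ 'n) \<times> (real ^ 'm). norm (snd w') powr (- \<beta>)) \<in> borel_measurable lebesgue"
      by (intro measurable_completion; measurable)+
    then show ?thesis
      unfolding weighted_def using that by (intro borel_measurable_scaleR)
  qed
  have AE: "AE w' in lebesgue. riesz_kernel l (w - w') *\<^sub>R weighted \<beta> f w'
      = riesz_kernel l (w - w') *\<^sub>R weighted \<beta> g w'" for w
    using fg by eventually_elim (simp add: weighted_def)
  have "convolution (riesz_kernel l) (weighted \<beta> f) = convolution (riesz_kernel l) (weighted \<beta> g)"
    unfolding convolution_def by (intro ext integral_cong_AE wf f g' AE)
  moreover have "convolution_exists_at (riesz_kernel l) (weighted \<beta> f)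
      = convolution_exists_at (riesz_kernel l) (weighted \<beta> g)"
    unfolding convolution_exists_at_def by (intro ext integrable_cong_AE wf f g' AE)
  moreover have "Lp_norm p lebesgue f = Lp_norm p lebesgue g"
    by (simp add: Lp_norm_def norm_eq)
  ultimately show ?thesis
    using stein_weiss_borel[OF assms(1-9) g Lp] by simp
qed

end
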